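(* There exists a constant $c_1>0$ such that $Q\big(\mathrm{DYCK}_{c_1\ell,\,n}\big)=\Omega\big(2^{\ell/2}\sqrt{n}\big)$.
   Context: For $x=x_1\cdots x_n\in\{0,1\}^n$, interpret $x_i=0$ as "(" and $x_i=1$ as ")". Let $f(y)=|y|_0-|y|_1$. $\mathrm{DYCK}_{k,n}(x)=1$ iff $f(x)=0$ and every prefix $p$ of $x$ satisfies $0\le f(p)\le k$. $Q(g)$ denotes the bounded-error (success probability at least $2/3$) quantum query complexity of $g$ in the standard oracle model. Here $\ell$ is a positive integer parameter.
   Formalization: The bound is proved for even n only (for odd n the function is constantly 0, so Q=0) and for n at least B^ℓ with an absolute constant B, since Q ≤ n rules out a bound for ℓ large compared with log n; the Ω constant is independent of ℓ. *)

theory Defs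
  imports
    "HOL-Analysis.Analysis"
    "HOL-Library.Sublist"
    "HOL-Library.Extended_Nat"
    "HOL-Library.Extended_Real"
    "Jordan_Normal_Form.Schur_Decomposition"
begin

text \<open>Bit strings are boolean lists: \<open>False\<close> is the bit 0, i.e. an opening parenthesis, and
  \<open>True\<close> is the bit 1, i.e. a closing parenthesis.\<close>

definition balance :: "bool list \<Rightarrow> int" where
  "balance y = int (count_list y False) - int (count_list y True)"

definition dyck :: "nat \<Rightarrow> bool list \<Rightarrow> bool" where
  "dyck k x \<longleftrightarrow> balance x = 0 \<and> (\<forall>p. prefix p x \<longrightarrow> 0 \<le> balance p \<and> balance p \<le> int k)"

definition unitary :: "nat \<Rightarrow> complex mat \<Rightarrow> bool" where
  "unitary d U \<longleftrightarrow> U \<in> carrier_mat d d \<and> mat_adjoint U * U = 1\<^sub>m d"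

text \<open>The state space of an algorithm on inputs of length \<open>n\<close> (with \<open>n > 0\<close>) is the tensor
  product of an index register (dimension \<open>n\<close>), an answer qubit and a workspace of dimension \<open>w\<close>.
  The basis state \<open>|i, b, z>\<close> is the unit vector whose position is \<open>basis_index w i b z\<close>.
  Input positions are numbered from 0.\<close>

definition state_dim :: "nat \<Rightarrow> nat \<Rightarrow> nat" where
  "state_dim n w = n * 2 * w"

definition basis_index :: "nat \<Rightarrow> nat \<Rightarrow> bool \<Rightarrow> nat \<Rightarrow> nat" where
  "basis_index w i b z = (i * 2 + of_bool b) * w + z"

text \<open>The oracle maps \<open>|i, b, z>\<close> to \<open>|i, b XOR x_i, z>\<close>.\<close>

definition query_mat :: "nat \<Rightarrow> nat \<Rightarrow> bool list \<Rightarrow> complex mat" where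
  "query_mat n w x = mat (state_dim n w) (state_dim n w) (\<lambda>(r, c).
     if \<exists>i b z. i < n \<and> z < w \<and> c = basis_index w i b z \<and> r = basis_index w i (b \<noteq> x ! i) z
     then 1 else 0)"

text \<open>After \<open>t\<close> queries the state is \<open>U\<^sub>t O\<^sub>x U\<^sub>t\<^sub>-\<^sub>1 \<dots> O\<^sub>x U\<^sub>0 |0>\<close>.\<close>

primrec query_state ::
  "nat \<Rightarrow> nat \<Rightarrow> (nat \<Rightarrow> complex mat) \<Rightarrow> bool list \<Rightarrow> nat \<Rightarrow> complex vec" where
  "query_state n w U x 0 = U 0 *\<^sub>v unit_vec (state_dim n w) 0"
| "query_state n w U x (Suc t) = U (Suc t) *\<^sub>v (query_mat n w x *\<^sub>v query_state n w U x t)"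

definition measure_prob :: "complex vec \<Rightarrow> nat set \<Rightarrow> real" where
  "measure_prob v A = (\<Sum>j \<in> A. (cmod (v $ j))\<^sup>2)"

text \<open>The algorithm outputs 1 iff measuring the final state in the standard basis gives an element
  of \<open>A\<close>; it has to output \<open>g x\<close> with probability at least 2/3 on every input \<open>x\<close> of length \<open>n\<close>.\<close>

definition quantum_computes :: "nat \<Rightarrow> (bool list \<Rightarrow> bool) \<Rightarrow> nat \<Rightarrow> bool" where
  "quantum_computes n g T \<longleftrightarrow>
     (\<exists>w U A. (\<forall>t \<le> T. unitary (state_dim n w) (U t)) \<and> A \<subseteq> {..<state_dim n w} \<and>
        (\<forall>x. length x = n \<longrightarrow>
           measure_prob (query_state n w U x T) (if g x then A else {..<state_dim n w} - A) \<ge> 2 / 3))"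

text \<open>For \<open>n > 0\<close> the set is nonempty, since \<open>n\<close> queries always suffice.\<close>

definition quantum_query_complexity :: "nat \<Rightarrow> (bool list \<Rightarrow> bool) \<Rightarrow> enat" where
  "quantum_query_complexity n g = (INF T \<in> {T. quantum_computes n g T}. enat T)"

end

theory Submission
  imports Defs
begin

text \<open>The proof is the quantum adversary argument in its simplest form, where all related pairs of
  inputs differ in one bit: if every \<open>x\<close> in a set \<open>X\<close> of accepted inputs has \<open>m\<close> bit flips leading
  into a set \<open>Y\<close> of rejected inputs, and every \<open>y\<close> in \<open>Y\<close> has \<open>m'\<close> bit flips leading into \<open>X\<close>, then
  \<open>\<Omega>(sqrt (m m'))\<close> queries are needed.

  Hard inputs are encodings of 8-ary trees in which a node has value 0 or 1 according to whether 4 or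
  5 of its children have value 1. A node of value 0 or 1 becomes a string of balance 1 or -1: after
  concatenating the children the balance is 0 or -2, and one more opening parenthesis restores the
  invariant. Hence the height grows by a constant per level, the length by a factor of about 8,
  and a tree of value 0 or 1 of depth \<open>l\<close> has \<open>4\<^sup>l\<close> or \<open>5\<^sup>l\<close> leaves whose flip changes its value. With
  \<open>N \<approx> n / 8\<^sup>l\<close> trees side by side, and \<open>X\<close> (\<open>Y\<close>) the inputs where no (exactly one) tree has value 0,
  we get \<open>m m' = N 5\<^sup>l 4\<^sup>l\<close>, which is at least of order \<open>2\<^sup>l n\<close>.\<close>

subsection \<open>Tree-shaped strings and their bit flips\<close>

definition flip :: "bool list \<Rightarrow> nat \<Rightarrow> bool list" where
  "flip s i = s[i := \<not> s ! i]"

definition flips :: "bool list set \<Rightarrow> bool list \<Rightarrow> nat" where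
  "flips P s = card {i. i < length s \<and> flip s i \<in> P}"

lemma length_flip [simp]: "length (flip s i) = length s"
  by (simp add: flip_def)

lemma flip_flip [simp]: "flip (flip s i) i = s"
  by (cases "i < length s") (simp_all add: flip_def list_update_beyond)

lemma nth_flip: "j < length s \<Longrightarrow> flip s i ! j = (if i = j then \<not> s ! j else s ! j)"
  by (simp add: flip_def)

lemma flips_mono: "P \<subseteq> Q \<Longrightarrow> flips P s \<le> flips Q s"
  unfolding flips_def by (intro card_mono) auto

text \<open>A flipped position lies in exactly one of the two parts, with the other part as fixed
  context. This lets flips be counted by induction along a concatenation.\<close>

lemma flips_append: "flips P (s @ t) = flips {u. u @ t \<in> P} s + flips {u. s @ u \<in> P} t"
proof -
  let ?A = "{i. i < length s \<and> flip s i @ t \<in> P}"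
  let ?B = "{i. i < length t \<and> s @ flip t i \<in> P}"
  have split: "flip (s @ t) i = (if i < length s then flip s i @ t else s @ flip t (i - length s))" for i
    by (simp add: flip_def list_update_append nth_append)
  have "{i. i < length (s @ t) \<and> flip (s @ t) i \<in> P} = ?A \<union> (+) (length s) ` ?B"
  proof (intro Set.set_eqI iffI)
    fix i assume i: "i \<in> {i. i < length (s @ t) \<and> flip (s @ t) i \<in> P}"
    show "i \<in> ?A \<union> (+) (length s) ` ?B"
    proof (cases "i < length s")
      case False
      then have "i = length s + (i - length s)" "i - length s \<in> ?B"
        using i by (auto simp: split)
      then show ?thesis by blast
    qed (use i in \<open>auto simp: split\<close>)
  qed (auto simp: split)
  moreover have "card (?A \<union> (+) (length s) ` ?B) = card ?A + card ((+) (length s) ` ?B)"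
    by (intro card_Un_disjoint) auto
  ultimately show ?thesis
    by (simp add: flips_def card_image)
qed

lemma flips_surround: "flips P s \<le> flips ((\<lambda>s. u @ s @ v) ` P) (u @ s @ v)"
proof -
  have "flips P s \<le> flips {t. u @ t @ v \<in> (\<lambda>s. u @ s @ v) ` P} s"
    by (intro flips_mono) auto
  then show ?thesis
    by (simp add: flips_append)
qed

text \<open>Both the children of a tree node and the row of trees in an input have this shape. The
  order of the values is free, and the counts are relative to \<open>b\<close>, so for either value
  changing one block of value \<open>b\<close> leads from \<open>Suc a\<close>, \<open>c\<close> to
  \<open>a\<close>, \<open>Suc c\<close>.\<close>

definition blocks :: "(bool \<Rightarrow> bool list set) \<Rightarrow> bool \<Rightarrow> nat \<Rightarrow> nat \<Rightarrow> bool list set" where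
  "blocks P b a c = {concat ss | ss vs. list_all2 (\<lambda>s v. s \<in> P v) ss vs \<and>
     count_list vs b = a \<and> count_list vs (\<not> b) = c}"

lemma blocks_swap: "blocks P b a c = blocks P (\<not> b) c a"
  unfolding blocks_def by auto

text \<open>Each of the \<open>Suc a\<close> blocks of value \<open>b\<close> can be turned into one
  of the other value in at least \<open>d\<close> ways, and flips in different blocks use different
  positions.\<close>

lemma flips_concat:
  assumes "list_all2 (\<lambda>s v. s \<in> P v) ss vs"
    and "\<And>s. s \<in> P b \<Longrightarrow> d \<le> flips (P (\<not> b)) s"
    and "count_list vs b = Suc a" and "count_list vs (\<not> b) = c"
  shows "Suc a * d \<le> flips (blocks P b a (Suc c)) (concat ss)"
  using assms(1,3,4)
proof (induction arbitrary: a c rule: list_all2_induct)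
  case Nil
  then show ?case by simp
next
  case (Cons s ss v vs)
  show ?case
  proof (cases "v = b")
    case True
    have "flips (P (\<not> b)) s \<le> flips {u. u @ concat ss \<in> blocks P b a (Suc c)} s"
    proof (rule flips_mono, rule subsetI, rule CollectI)
      fix u assume "u \<in> P (\<not> b)"
      then show "u @ concat ss \<in> blocks P b a (Suc c)"
        using Cons True unfolding blocks_def
        by (intro CollectI exI[of _ "u # ss"] exI[of _ "(\<not> b) # vs"]) auto
    qed
    moreover have "d \<le> flips (P (\<not> b)) s"
      by (rule assms(2)) (use Cons.hyps True in blast)
    \<comment> \<open>For \<open>a = 0\<close> this is trivial; otherwise the tail still has a block
      of value \<open>b\<close>, as the induction hypothesis requires.\<close>
    moreover have "a * d \<le> flips {u. s @ u \<in> blocks P b a (Suc c)} (concat ss)"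
    proof (cases a)
      case (Suc a')
      have "flips (blocks P b a' (Suc c)) (concat ss)
          \<le> flips {u. s @ u \<in> blocks P b a (Suc c)} (concat ss)"
      proof (rule flips_mono, rule subsetI, rule CollectI)
        fix u assume "u \<in> blocks P b a' (Suc c)"
        then obtain ts ws where "u = concat ts" "list_all2 (\<lambda>s v. s \<in> P v) ts ws"
          "count_list ws b = a'" "count_list ws (\<not> b) = Suc c"
          unfolding blocks_def by blast
        then show "s @ u \<in> blocks P b a (Suc c)"
          using Cons.hyps True Suc unfolding blocks_def
          by (intro CollectI exI[of _ "s # ts"] exI[of _ "b # ws"]) auto
      qed
      then show ?thesis
        using Cons.IH[of a' c] Cons.prems True Suc by simp
    qed simp
    ultimately show ?thesis
      by (simp add: flips_append)
  next
    case False
    then obtain c' where c': "c = Suc c'" "count_list vs b = Suc a" "count_list vs (\<not> b) = c'"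
      using Cons.prems by (cases b; cases v; auto)
    have "flips (blocks P b a (Suc c')) (concat ss)
        \<le> flips {u. s @ u \<in> blocks P b a (Suc c)} (concat ss)"
    proof (rule flips_mono, rule subsetI, rule CollectI)
      fix u assume "u \<in> blocks P b a (Suc c')"
      then obtain ts ws where "u = concat ts" "list_all2 (\<lambda>s v. s \<in> P v) ts ws"
        "count_list ws b = a" "count_list ws (\<not> b) = Suc c'"
        unfolding blocks_def by blast
      then show "s @ u \<in> blocks P b a (Suc c)"
        using Cons.hyps False c' unfolding blocks_def
        by (intro CollectI exI[of _ "s # ts"] exI[of _ "v # ws"]) auto
    qed
    then show ?thesis
      using Cons.IH[of a c'] c' by (simp add: flips_append)
  qed
qed

lemma flips_blocks:
  assumes "s \<in> blocks P b (Suc a) c"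
    and "\<And>s. s \<in> P b \<Longrightarrow> d \<le> flips (P (\<not> b)) s"
  shows "Suc a * d \<le> flips (blocks P b a (Suc c)) s"
  using assms flips_concat unfolding blocks_def[of P b "Suc a"] by blast

section \<open>Length, balance and height of concatenations\<close>

lemma balance_append [simp]: "balance (s @ t) = balance s + balance t"
  by (simp add: balance_def)

lemma balance_simps [simp]:
  "balance [] = 0" "balance (b # s) = (if b then -1 else 1) + balance s"
  by (auto simp: balance_def)

lemma balance_replicate [simp]: "balance (replicate m b) = (if b then - int m else int m)"
  by (induction m) auto

lemma length_blocks:
  assumes "s \<in> blocks P b a c" "\<And>v s. s \<in> P v \<Longrightarrow> length s = L"
  shows "length s = (a + c) * L"
proof -
  obtain ss vs where all: "list_all2 (\<lambda>s v. s \<in> P v) ss vs"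
    and eq: "s = concat ss" "count_list vs b = a" "count_list vs (\<not> b) = c"
    using assms(1) unfolding blocks_def by blast
  from all have "length (concat ss) = (count_list vs b + count_list vs (\<not> b)) * L"
    using assms(2) by (induction rule: list_all2_induct) (auto simp: algebra_simps)
  then show ?thesis
    using eq by simp
qed

lemma balance_blocks:
  assumes "s \<in> blocks P b a c" "\<And>v s. s \<in> P v \<Longrightarrow> balance s = \<beta> v"
  shows "balance s = int a * \<beta> b + int c * \<beta> (\<not> b)"
proof -
  obtain ss vs where all: "list_all2 (\<lambda>s v. s \<in> P v) ss vs"
    and eq: "s = concat ss" "count_list vs b = a" "count_list vs (\<not> b) = c"
    using assms(1) unfolding blocks_def by blast
  from all have "balance (concat ss) = int (count_list vs b) * \<beta> b + int (count_list vs (\<not> b)) * \<beta> (\<not> b)"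
    using assms(2) by (induction rule: list_all2_induct) (auto simp: algebra_simps)
  then show ?thesis
    using eq by simp
qed

text \<open>Two-sided, since encoded trees may dip below 0; \<open>padded\<close> shifts this band
  into the range allowed by \<open>dyck\<close>.\<close>

definition height_le :: "nat \<Rightarrow> bool list \<Rightarrow> bool" where
  "height_le h s \<longleftrightarrow> (\<forall>p. prefix p s \<longrightarrow> \<bar>balance p\<bar> \<le> int h)"

lemma height_le_mono: "height_le h s \<Longrightarrow> h \<le> h' \<Longrightarrow> height_le h' s"
  unfolding height_le_def by fastforce

lemma height_le_append:
  assumes "height_le h s" "height_le h' t" "\<bar>balance s\<bar> + int h' \<le> int h"
  shows "height_le h (s @ t)"
  unfolding height_le_def prefix_append
proof (intro allI impI, elim disjE exE conjE)
  fix p q assume "p = s @ q" "prefix q t"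
  moreover from this have "\<bar>balance q\<bar> \<le> int h'"
    using assms(2) by (simp add: height_le_def)
  ultimately show "\<bar>balance p\<bar> \<le> int h"
    using assms(3) by simp
qed (use assms(1) in \<open>simp add: height_le_def\<close>)

text \<open>A prefix ends inside some block, after complete blocks whose balances are bounded by
  \<open>\<delta>\<close>. Blocks with \<open>\<delta>\<close> equal to 0 cost nothing, so any
  number of them fits into a constant height.\<close>

lemma height_le_blocks:
  assumes "s \<in> blocks P b a c"
    and "\<And>v s. s \<in> P v \<Longrightarrow> height_le h s"
    and "\<And>v s. s \<in> P v \<Longrightarrow> \<bar>balance s\<bar> \<le> int (\<delta> v)"
  shows "height_le (h + a * \<delta> b + c * \<delta> (\<not> b)) s"
proof -
  obtain ss vs where all: "list_all2 (\<lambda>s v. s \<in> P v) ss vs"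
    and eq: "s = concat ss" "count_list vs b = a" "count_list vs (\<not> b) = c"
    using assms(1) unfolding blocks_def by blast
  from all have "height_le (h + count_list vs b * \<delta> b + count_list vs (\<not> b) * \<delta> (\<not> b)) (concat ss)"
  proof (induction rule: list_all2_induct)
    case Nil
    then show ?case by (simp add: height_le_def)
  next
    case (Cons s ss v vs)
    let ?k = "h + count_list vs b * \<delta> b + count_list vs (\<not> b) * \<delta> (\<not> b)"
    have k: "h + count_list (v # vs) b * \<delta> b + count_list (v # vs) (\<not> b) * \<delta> (\<not> b) = ?k + \<delta> v"
      by (cases b; cases v) (simp_all add: algebra_simps)
    have "height_le h s" "\<bar>balance s\<bar> \<le> int (\<delta> v)"
      using assms(2,3) Cons.hyps by auto
    moreover have "height_le ?k (concat ss)"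
      using Cons by simp
    ultimately have "height_le (?k + \<delta> v) (s @ concat ss)"
      by (intro height_le_append[of _ _ ?k]) (auto elim: height_le_mono)
    then show ?case
      unfolding k by simp
  qed
  then show ?thesis
    using eq by simp
qed

lemma blocks_nonempty:
  assumes "P True \<noteq> {}" "P False \<noteq> {}"
  shows "blocks P b a c \<noteq> {}"
proof -
  obtain u w where "u \<in> P True" "w \<in> P False"
    using assms by blast
  then have t: "(if v then u else w) \<in> P v" for v
    by simp
  let ?t = "\<lambda>v. if v then u else w"
  let ?vs = "replicate a b @ replicate c (\<not> b)"
  have count: "count_list (replicate m x) y = (if x = y then m else 0)" for m and x y :: bool
    by (induction m) auto
  have "list_all2 (\<lambda>s v. s \<in> P v) (map ?t ?vs) ?vs"
    using t by (simp only: list_all2_map1 list.rel_refl)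
  then have "concat (map ?t ?vs) \<in> blocks P b a c"
    unfolding blocks_def
    by (intro CollectI exI[of _ "map ?t ?vs"] exI[of _ ?vs]) (simp add: count)
  then show ?thesis by blast
qed

section \<open>Encoded trees: length, balance, height and sensitivity\<close>

primrec tree :: "nat \<Rightarrow> bool \<Rightarrow> bool list set" where
  "tree 0 b = {[b]}"
| "tree (Suc j) b = (\<lambda>s. s @ [False]) ` blocks (tree j) b (if b then 5 else 4) (if b then 3 else 4)"

lemma tree_nonempty: "tree j b \<noteq> {}"
proof (induction j arbitrary: b)
  case (Suc j)
  then show ?case by (simp add: blocks_nonempty)
qed simp

text \<open>The lengths satisfy L' = 8 L + 1; the closed form is multiplied by 7 to avoid
  division.\<close>

lemma length_tree: "s \<in> tree j b \<Longrightarrow> 7 * length s + 1 = 8 ^ Suc j"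
proof (induction j arbitrary: s b)
  case (Suc j)
  obtain u where u: "s = u @ [False]" "u \<in> blocks (tree j) b (if b then 5 else 4) (if b then 3 else 4)"
    using Suc.prems by auto
  have "length t = (8 ^ Suc j - 1) div 7" if "t \<in> tree j v" for t v
    using Suc.IH[OF that] by linarith
  from length_blocks[OF u(2) this] have "length u = 8 * ((8 ^ Suc j - 1) div 7)"
    by (cases b) auto
  moreover obtain t where "t \<in> tree j b"
    using tree_nonempty by blast
  ultimately have "length u = 8 * length t" "7 * length t + 1 = 8 ^ Suc j"
    using Suc.IH[of t b] by simp_all
  then show ?case
    using u(1) by simp
qed simp

lemma balance_tree: "s \<in> tree j b \<Longrightarrow> balance s = (if b then -1 else 1)"
proof (induction j arbitrary: s b)
  case (Suc j)
  obtain u where u: "s = u @ [False]" "u \<in> blocks (tree j) b (if b then 5 else 4) (if b then 3 else 4)"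
    using Suc.prems by auto
  show ?case
    using balance_blocks[OF u(2) Suc.IH] u(1) by (cases b) auto
qed simp

lemma height_le_single: "height_le (Suc 0) [b]"
  by (auto simp: height_le_def prefix_Cons)

text \<open>Eight children of balance 1 or -1 raise the height by at most 8 and the appended
  parenthesis by at most 1, hence 9 per level.\<close>

lemma height_le_tree: "s \<in> tree j b \<Longrightarrow> height_le (9 * j + 1) s"
proof (induction j arbitrary: s b)
  case 0
  then show ?case by (simp add: height_le_single)
next
  case (Suc j)
  obtain u where u: "s = u @ [False]" "u \<in> blocks (tree j) b (if b then 5 else 4) (if b then 3 else 4)"
    using Suc.prems by auto
  have "height_le (9 * j + 1 + (if b then 5 else 4) * 1 + (if b then 3 else 4) * 1) u"
    by (rule height_le_blocks[OF u(2) Suc.IH]) (auto simp: balance_tree)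
  then have "height_le (9 * j + 9) u"
    by (cases b) (simp_all add: ac_simps)
  then have "height_le (9 * Suc j + 1) u"
    by (rule height_le_mono) simp
  moreover have "\<bar>balance u\<bar> \<le> 2"
    using balance_tree[OF Suc.prems] u(1) by (auto split: if_splits)
  ultimately show ?case
    unfolding u(1) by (intro height_le_append[OF _ height_le_single]) auto
qed

text \<open>A node of value 1 changes when any of its 5 children of value 1 does, a node of value 0
  when any of its 4 children of value 0 does. These children share the value of the node, so the
  same factor 5 or 4 arises on every level.\<close>

lemma flips_tree: "s \<in> tree j b \<Longrightarrow> (if b then 5 else 4) ^ j \<le> flips (tree j (\<not> b)) s"
proof (induction j arbitrary: s b)
  case 0
  then have "{i. i < length s \<and> flip s i \<in> tree 0 (\<not> b)} = {0}"
    by (auto simp: flip_def)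
  then show ?case
    by (simp add: flips_def)
next
  case (Suc j)
  obtain u where u: "s = u @ [False]" "u \<in> blocks (tree j) b (if b then 5 else 4) (if b then 3 else 4)"
    using Suc.prems by auto
  then have u': "u \<in> blocks (tree j) b (Suc (if b then 4 else 3)) (if b then 3 else 4)"
    by (cases b) (auto simp: eval_nat_numeral)
  \<comment> \<open>One block of value \<open>b\<close> less and one more of the other value give
    exactly the counts of the opposite node.\<close>
  have eq: "blocks (tree j) b (if b then 4 else 3) (Suc (if b then 3 else 4)) =
      blocks (tree j) (\<not> b) (if \<not> b then 5 else 4) (if \<not> b then 3 else 4)"
    by (subst blocks_swap) (cases b; simp)
  show ?case
    using flips_blocks[OF u' Suc.IH] flips_surround[of _ u "[]" "[False]"]
    unfolding u(1) eq by (cases b) (auto intro: order_trans)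
qed

subsection \<open>The adversary bound for single-bit flips\<close>

unbundle no vec_syntax

text \<open>The positions in interval \<open>i\<close> are those of the basis states with index
  register \<open>i\<close>, where a query reads bit \<open>i\<close>.\<close>

lemma state_blocks: "(\<Sum>i<n. \<Sum>j\<in>{i * (2 * w)..<i * (2 * w) + 2 * w}. f j) = sum f {..<state_dim n w}"
  by (simp add: sum.nat_group state_dim_def mult.assoc)

definition inner_vec :: "nat \<Rightarrow> complex vec \<Rightarrow> complex vec \<Rightarrow> complex" where
  "inner_vec d u v = (\<Sum>j<d. u $ j * cnj (v $ j))"

lemma inner_vec_unitary:
  assumes U: "unitary d U" and u: "u \<in> carrier_vec d" and v: "v \<in> carrier_vec d"
  shows "inner_vec d (U *\<^sub>v u) (U *\<^sub>v v) = inner_vec d u v"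
proof -
  have dim: "dim_row U = d" "dim_col U = d"
    using U by (auto simp: unitary_def)
  have orth: "(\<Sum>i<d. U $$ (i, a) * cnj (U $$ (i, b))) = (if a = b then 1 else 0)"
    if "a < d" "b < d" for a b
  proof -
    have "(\<Sum>i<d. U $$ (i, a) * cnj (U $$ (i, b))) = (mat_adjoint U * U) $$ (b, a)"
      using that dim
      by (simp add: mat_adjoint_def mat_of_rows_def scalar_prod_def conjugate_complex_def mult.commute atLeast0LessThan)
    also have "mat_adjoint U * U = 1\<^sub>m d"
      using U by (simp add: unitary_def)
    finally show ?thesis
      using that by auto
  qed
  have mult: "(U *\<^sub>v x) $ i = (\<Sum>a<d. U $$ (i, a) * x $ a)" if "x \<in> carrier_vec d" "i < d" for x i
    using that dim by (auto simp: scalar_prod_def atLeast0LessThan)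
  have "inner_vec d (U *\<^sub>v u) (U *\<^sub>v v)
      = (\<Sum>i<d. \<Sum>a<d. \<Sum>b<d. (U $$ (i, a) * u $ a) * (cnj (U $$ (i, b)) * cnj (v $ b)))"
    by (simp add: inner_vec_def mult u v sum_product)
  also have "\<dots> = (\<Sum>a<d. \<Sum>b<d. \<Sum>i<d. (U $$ (i, a) * u $ a) * (cnj (U $$ (i, b)) * cnj (v $ b)))"
    by (subst sum.swap) (intro sum.cong refl sum.swap)
  also have "\<dots> = (\<Sum>a<d. \<Sum>b<d. u $ a * cnj (v $ b) * (\<Sum>i<d. U $$ (i, a) * cnj (U $$ (i, b))))"
    by (simp add: sum_distrib_left ac_simps)
  also have "\<dots> = (\<Sum>a<d. \<Sum>b<d. if a = b then u $ a * cnj (v $ b) else 0)"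
    by (intro sum.cong refl) (simp add: orth)
  also have "\<dots> = inner_vec d u v"
    by (simp add: inner_vec_def)
  finally show ?thesis .
qed

section \<open>The oracle as an involutive permutation of the basis states\<close>

definition query_perm :: "nat \<Rightarrow> bool list \<Rightarrow> nat \<Rightarrow> nat" where
  "query_perm w x j =
     basis_index w (j div (2 * w)) (odd (j div w) \<noteq> x ! (j div (2 * w))) (j mod w)"

lemma basis_index_div_mod:
  assumes "z < w"
  shows "basis_index w i b z div w = i * 2 + of_bool b"
    and "basis_index w i b z mod w = z"
    and "basis_index w i b z div (2 * w) = i"
    and "odd (basis_index w i b z div w) = b"
proof -
  show div: "basis_index w i b z div w = i * 2 + of_bool b"
    using assms by (simp add: basis_index_def)
  show "basis_index w i b z mod w = z"
    using assms by (simp add: basis_index_def)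
  show "basis_index w i b z div (2 * w) = i"
    by (simp add: mult.commute[of 2] div_mult2_eq div)
  show "odd (basis_index w i b z div w) = b"
    by (simp add: div)
qed

lemma basis_index_eta: "basis_index w (j div (2 * w)) (odd (j div w)) (j mod w) = j"
proof -
  have "j div (2 * w) * 2 + of_bool (odd (j div w)) = j div w"
    by (simp add: mult.commute[of 2 w] div_mult2_eq of_bool_odd_eq_mod_2)
  then show ?thesis
    by (simp add: basis_index_def)
qed

lemma query_perm_div: "w > 0 \<Longrightarrow> query_perm w x j div (2 * w) = j div (2 * w)"
  by (simp add: query_perm_def basis_index_div_mod)

lemma query_perm_invol: "w > 0 \<Longrightarrow> query_perm w x (query_perm w x j) = j"
proof -
  assume w: "w > 0"
  have "((odd (j div w) \<noteq> x ! (j div (2 * w))) \<noteq> x ! (j div (2 * w))) = odd (j div w)"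
    by blast
  then show ?thesis
    using w basis_index_eta[of w j]
    by (subst query_perm_def) (simp add: query_perm_def[of w x j] basis_index_div_mod)
qed

lemma query_perm_less:
  assumes "j < state_dim n w"
  shows "query_perm w x j < state_dim n w"
proof -
  have "w > 0"
    using assms by (cases w) (auto simp: state_dim_def)
  then show ?thesis
    using assms query_perm_div[of w x j] unfolding state_dim_def mult.assoc
    by (metis div_less_iff_less_mult mult_pos_pos zero_less_numeral)
qed

text \<open>The single 1 in row \<open>j\<close> is in the column that the permutation sends to
  \<open>j\<close>; for an involution this is \<open>query_perm w x j\<close>.\<close>

lemma query_mat_apply:
  assumes v: "v \<in> carrier_vec (state_dim n w)" and j: "j < state_dim n w"
  shows "(query_mat n w x *\<^sub>v v) $ j = v $ query_perm w x j"
proof -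
  have w: "w > 0"
    using j by (cases w) (auto simp: state_dim_def)
  have i: "j div (2 * w) < n"
    using j w by (simp add: state_dim_def mult.assoc div_less_iff_less_mult)
  have iff: "(\<exists>i b z. i < n \<and> z < w \<and> c = basis_index w i b z \<and> j = basis_index w i (b \<noteq> x ! i) z)
      \<longleftrightarrow> c = query_perm w x j" (is "?lhs \<longleftrightarrow> ?rhs") for c
  proof
    assume ?lhs
    then obtain i b z where *: "z < w" "c = basis_index w i b z" "j = basis_index w i (b \<noteq> x ! i) z"
      by blast
    then have "((b \<noteq> x ! i) \<noteq> x ! i) = b" by blast
    then show ?rhs
      using * by (simp add: query_perm_def basis_index_div_mod)
  next
    assume ?rhs
    let ?i = "j div (2 * w)"
    have "((odd (j div w) \<noteq> x ! ?i) \<noteq> x ! ?i) = odd (j div w)" by blast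
    then have "j = basis_index w ?i ((odd (j div w) \<noteq> x ! ?i) \<noteq> x ! ?i) (j mod w)"
      using basis_index_eta[of w j] by simp
    then show ?lhs
      using i w \<open>?rhs\<close> unfolding query_perm_def
      by (intro exI[of _ ?i] exI[of _ "odd (j div w) \<noteq> x ! ?i"] exI[of _ "j mod w"]) simp
  qed
  have "query_mat n w x $$ (j, c) = (if c = query_perm w x j then 1 else 0)"
    if "c < state_dim n w" for c
    unfolding query_mat_def using that j by (simp only: index_mat split iff)
  moreover have "(query_mat n w x *\<^sub>v v) $ j = (\<Sum>c<state_dim n w. query_mat n w x $$ (j, c) * v $ c)"
    using v j by (simp add: query_mat_def scalar_prod_def atLeast0LessThan)
  ultimately have "(query_mat n w x *\<^sub>v v) $ j
      = (\<Sum>c<state_dim n w. (if c = query_perm w x j then 1 else 0) * v $ c)"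
    by simp
  also have "\<dots> = v $ query_perm w x j"
    using query_perm_less[OF j] by (simp add: if_distrib[of "\<lambda>c. c * _"] cong: if_cong)
  finally show ?thesis .
qed

lemma block_iff:
  fixes i j w :: nat
  assumes "w > 0"
  shows "j \<in> {i * (2 * w)..<i * (2 * w) + 2 * w} \<longleftrightarrow> j div (2 * w) = i"
proof -
  have "j div (2 * w) = i \<longleftrightarrow> i \<le> j div (2 * w) \<and> j div (2 * w) < Suc i"
    by auto
  also have "\<dots> \<longleftrightarrow> i * (2 * w) \<le> j \<and> j < Suc i * (2 * w)"
    using assms by (simp only: less_eq_div_iff_mult_less_eq div_less_iff_less_mult mult_pos_pos zero_less_numeral)
  finally show ?thesis by (simp add: add.commute)
qed

lemma sum_query_perm:
  assumes "w > 0"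
  shows "(\<Sum>j\<in>{i * (2 * w)..<i * (2 * w) + 2 * w}. f (query_perm w x j))
    = (\<Sum>j\<in>{i * (2 * w)..<i * (2 * w) + 2 * w}. f j)"
  by (rule sum.reindex_bij_witness[of _ "query_perm w x" "query_perm w x"])
     (simp_all only: block_iff[OF assms] query_perm_invol[OF assms] query_perm_div[OF assms])

text \<open>The permutation maps interval \<open>i\<close> to itself and depends there on the input
  only through bit \<open>i\<close>, so both factors are permuted alike.\<close>

lemma sum_query_perm_pair:
  assumes "w > 0" "x ! i = y ! i"
  shows "(\<Sum>j\<in>{i * (2 * w)..<i * (2 * w) + 2 * w}. a $ query_perm w x j * cnj (b $ query_perm w y j))
    = (\<Sum>j\<in>{i * (2 * w)..<i * (2 * w) + 2 * w}. a $ j * cnj (b $ j))" (is "?l = ?r")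
proof -
  have "?l = (\<Sum>j\<in>{i * (2 * w)..<i * (2 * w) + 2 * w}.
      a $ query_perm w x j * cnj (b $ query_perm w x j))"
    using assms(2) by (intro sum.cong refl) (simp only: query_perm_def block_iff[OF assms(1)])
  then show ?thesis
    using sum_query_perm[OF assms(1), of "\<lambda>j. a $ j * cnj (b $ j)"] by simp
qed

lemma inner_vec_query:
  assumes "a \<in> carrier_vec (state_dim n w)" "b \<in> carrier_vec (state_dim n w)"
  shows "inner_vec (state_dim n w) (query_mat n w x *\<^sub>v a) (query_mat n w y *\<^sub>v b)
    = (\<Sum>i<n. \<Sum>j\<in>{i * (2 * w)..<i * (2 * w) + 2 * w}.
        a $ query_perm w x j * cnj (b $ query_perm w y j))"
  using assms by (simp add: inner_vec_def query_mat_apply state_blocks)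

lemma inner_vec_query_same:
  assumes "w > 0" "a \<in> carrier_vec (state_dim n w)" "b \<in> carrier_vec (state_dim n w)"
  shows "inner_vec (state_dim n w) (query_mat n w x *\<^sub>v a) (query_mat n w x *\<^sub>v b)
    = inner_vec (state_dim n w) a b"
  using assms by (simp add: inner_vec_query sum_query_perm_pair state_blocks) (simp add: inner_vec_def)

section \<open>Change of inner products under one query\<close>

lemma am_gm_weighted:
  fixes p q r :: real
  assumes "r > 0"
  shows "p * q \<le> (r * p\<^sup>2 + q\<^sup>2 / r) / 2"
proof -
  have "0 \<le> (r * p - q)\<^sup>2 / r"
    using assms by simp
  also have "\<dots> = r * p\<^sup>2 + q\<^sup>2 / r - 2 * (p * q)"
    using assms by (simp add: field_simps power2_eq_square)
  finally show ?thesis by simp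
qed

text \<open>Takes the place of Cauchy-Schwarz: the bound is linear in the two masses, so it can be
  summed over many pairs, and \<open>r\<close> is free to balance families of different
  sizes.\<close>

lemma cmod_sum_am_gm:
  assumes "r > 0"
  shows "cmod (\<Sum>j\<in>J. f j * cnj (g j)) \<le> (r * (\<Sum>j\<in>J. (cmod (f j))\<^sup>2) + (\<Sum>j\<in>J. (cmod (g j))\<^sup>2) / r) / 2"
proof -
  have "cmod (\<Sum>j\<in>J. f j * cnj (g j)) \<le> (\<Sum>j\<in>J. cmod (f j) * cmod (g j))"
    by (rule order_trans[OF norm_sum]) (simp add: norm_mult)
  also have "\<dots> \<le> (\<Sum>j\<in>J. (r * (cmod (f j))\<^sup>2 + (cmod (g j))\<^sup>2 / r) / 2)"
    by (intro sum_mono am_gm_weighted assms)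
  also have "\<dots> = (r * (\<Sum>j\<in>J. (cmod (f j))\<^sup>2) + (\<Sum>j\<in>J. (cmod (g j))\<^sup>2) / r) / 2"
    by (simp add: sum.distrib sum_distrib_left flip: sum_divide_distrib)
  finally show ?thesis .
qed

text \<open>The inputs differ only in bit \<open>i\<close>, so only the contribution of interval
  \<open>i\<close> changes. Its old and new values are each at most half of the bound.\<close>

lemma inner_vec_query_flip:
  assumes w: "w > 0" and ab: "a \<in> carrier_vec (state_dim n w)" "b \<in> carrier_vec (state_dim n w)"
    and i: "i < n" "length x = n" and r: "r > 0"
  shows "cmod (inner_vec (state_dim n w) a b -
      inner_vec (state_dim n w) (query_mat n w x *\<^sub>v a) (query_mat n w (flip x i) *\<^sub>v b))
    \<le> r * measure_prob a {i * (2 * w)..<i * (2 * w) + 2 * w} +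
       measure_prob b {i * (2 * w)..<i * (2 * w) + 2 * w} / r"
proof -
  let ?B = "\<lambda>i. {i * (2 * w)..<i * (2 * w) + 2 * w}"
  let ?p = "query_perm w x" and ?q = "query_perm w (flip x i)"
  let ?s = "\<lambda>i. \<Sum>j\<in>?B i. a $ j * cnj (b $ j)"
  let ?t = "\<lambda>i. \<Sum>j\<in>?B i. a $ ?p j * cnj (b $ ?q j)"
  have eq: "?t m = ?s m" if "m < n" "m \<noteq> i" for m
    using that i by (intro sum_query_perm_pair w) (simp add: nth_flip)
  have "inner_vec (state_dim n w) a b -
      inner_vec (state_dim n w) (query_mat n w x *\<^sub>v a) (query_mat n w (flip x i) *\<^sub>v b)
    = (\<Sum>m<n. ?s m) - (\<Sum>m<n. ?t m)"
    using ab by (simp add: inner_vec_query state_blocks) (simp add: inner_vec_def)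
  also have "\<dots> = (\<Sum>m<n. ?s m - ?t m)"
    by (simp add: sum_subtractf)
  also have "\<dots> = (\<Sum>m\<in>{i}. ?s m - ?t m)"
    using i eq by (intro sum.mono_neutral_right) auto
  finally have "cmod (inner_vec (state_dim n w) a b -
      inner_vec (state_dim n w) (query_mat n w x *\<^sub>v a) (query_mat n w (flip x i) *\<^sub>v b))
      \<le> cmod (?s i) + cmod (?t i)"
    using norm_triangle_ineq4[of "?s i" "?t i"] by simp
  also have "cmod (?s i) \<le> (r * measure_prob a (?B i) + measure_prob b (?B i) / r) / 2"
    unfolding measure_prob_def by (rule cmod_sum_am_gm[OF r])
  also have "cmod (?t i) \<le> (r * measure_prob a (?B i) + measure_prob b (?B i) / r) / 2"
    using cmod_sum_am_gm[OF r, of "\<lambda>j. a $ ?p j" "\<lambda>j. b $ ?q j" "?B i"]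
      sum_query_perm[OF w, of "\<lambda>j. (cmod (a $ j))\<^sup>2" x i]
      sum_query_perm[OF w, of "\<lambda>j. (cmod (b $ j))\<^sup>2" "flip x i" i]
    unfolding measure_prob_def by simp
  finally show ?thesis by (simp add: add_divide_distrib)
qed

section \<open>States of an algorithm and the final measurement\<close>

lemma query_mat_carrier: "query_mat n w x \<in> carrier_mat (state_dim n w) (state_dim n w)"
  by (simp add: query_mat_def)

lemma query_state_carrier:
  assumes "\<And>s. s \<le> t \<Longrightarrow> unitary (state_dim n w) (U s)"
  shows "query_state n w U x t \<in> carrier_vec (state_dim n w)"
  using assms query_mat_carrier[of n w x]
  by (induction t) (auto simp: unitary_def intro!: mult_mat_vec_carrier)

lemma inner_vec_self: "inner_vec d v v = of_real (measure_prob v {..<d})"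
  by (simp add: inner_vec_def measure_prob_def flip: complex_norm_square)

lemma query_state_norm:
  assumes "n > 0" "w > 0" "\<And>s. s \<le> t \<Longrightarrow> unitary (state_dim n w) (U s)"
  shows "inner_vec (state_dim n w) (query_state n w U x t) (query_state n w U x t) = 1"
  using assms(3)
proof (induction t)
  case 0
  have "inner_vec (state_dim n w) (unit_vec (state_dim n w) 0) (unit_vec (state_dim n w) 0) =
      (\<Sum>j<state_dim n w. if j = 0 then 1 else 0)"
    unfolding inner_vec_def by (intro sum.cong) auto
  also have "\<dots> = 1"
    using assms(1,2) by (simp add: state_dim_def)
  finally show ?case
    using 0 by (simp add: inner_vec_unitary)
next
  case (Suc t)
  then have "query_state n w U x t \<in> carrier_vec (state_dim n w)"
    by (intro query_state_carrier) simp
  then show ?case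
    using Suc assms(2) mult_mat_vec_carrier[OF query_mat_carrier]
    by (simp add: inner_vec_unitary inner_vec_query_same)
qed

lemma inner_vec_distinguish:
  assumes norm: "measure_prob u {..<d} = 1" "measure_prob v {..<d} = 1" and A: "A \<subseteq> {..<d}"
    and u: "measure_prob u A \<ge> 2 / 3" and v: "measure_prob v ({..<d} - A) \<ge> 2 / 3"
  shows "cmod (inner_vec d u v) \<le> 19 / 20"
proof -
  let ?A' = "{..<d} - A"
  have split: "sum f {..<d} = sum f A + sum f ?A'" for f :: "nat \<Rightarrow> 'a::comm_monoid_add"
    using A by (subst sum.subset_diff[OF A]) (simp_all add: add.commute)
  have masses: "measure_prob u ?A' = 1 - measure_prob u A" "measure_prob v A = 1 - measure_prob v ?A'"
    using norm split[of "\<lambda>j. (cmod (u $ j))\<^sup>2"] split[of "\<lambda>j. (cmod (v $ j))\<^sup>2"]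
    by (simp_all add: measure_prob_def)
  have "cmod (inner_vec d u v) \<le> cmod (\<Sum>j\<in>A. u $ j * cnj (v $ j)) + cmod (\<Sum>j\<in>?A'. u $ j * cnj (v $ j))"
    unfolding inner_vec_def by (subst split) (rule norm_triangle_ineq)
  \<comment> \<open>In the extreme case the masses are 2/3 and 1/3, with optimal weights sqrt (1/2)
    and sqrt 2; 7/10 and 10/7 approximate these, and 19/20 lies just above the extreme value 2 sqrt
    2 / 3.\<close>
  also have "\<dots> \<le> (7 / 10 * measure_prob u A + measure_prob v A / (7 / 10)) / 2 +
      (10 / 7 * measure_prob u ?A' + measure_prob v ?A' / (10 / 7)) / 2"
    unfolding measure_prob_def by (intro add_mono cmod_sum_am_gm) auto
  also have "\<dots> \<le> 19 / 20"
    using u v unfolding masses by (simp add: field_simps)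
  finally show ?thesis .
qed

lemma finite_bit_strings: "X \<subseteq> {x. length x = n} \<Longrightarrow> finite (X :: bool list set)"
  using finite_lists_length_eq[of "UNIV :: bool set" n] by (auto intro: finite_subset)

text \<open>The progress measure \<open>W\<close> sums the absolute inner products of the states
  over all related pairs. It starts at \<open>card R\<close>, must end at or below 19/20 of that,
  and loses at most \<open>2 * sqrt (card X * card Y)\<close> per query.\<close>

lemma sensitivity_adversary:
  assumes n: "n > 0" and comp: "quantum_computes n g T"
    and X: "X \<subseteq> {x. length x = n \<and> g x}" "X \<noteq> {}"
    and Y: "Y \<subseteq> {y. length y = n \<and> \<not> g y}" "Y \<noteq> {}"
    and m: "\<And>x. x \<in> X \<Longrightarrow> m \<le> flips Y x" and m': "\<And>y. y \<in> Y \<Longrightarrow> m' \<le> flips X y"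
  shows "sqrt (real m * real m') \<le> 40 * real T"
proof -
  obtain w U A where U: "\<And>t. t \<le> T \<Longrightarrow> unitary (state_dim n w) (U t)"
    and A: "A \<subseteq> {..<state_dim n w}"
    and correct: "\<And>x. length x = n \<Longrightarrow>
      2 / 3 \<le> measure_prob (query_state n w U x T) (if g x then A else {..<state_dim n w} - A)"
    using comp unfolding quantum_computes_def by blast
  define d where "d = state_dim n w"
  define \<psi> where "\<psi> = query_state n w U"
  let ?B = "\<lambda>i. {i * (2 * w)..<i * (2 * w) + 2 * w}"
  have w: "w > 0"
  proof (rule ccontr)
    assume "\<not> w > 0"
    then show False
      using correct[of "replicate n False"] A
      by (auto simp: state_dim_def measure_prob_def split: if_splits)
  qed
  have carrier: "\<psi> x t \<in> carrier_vec d" if "t \<le> T" for x t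
    using that U unfolding \<psi>_def d_def by (intro query_state_carrier) simp
  have self: "inner_vec d (\<psi> x t) (\<psi> x t) = 1" if "t \<le> T" for x t
    using that U w n unfolding \<psi>_def d_def by (intro query_state_norm) auto
  then have norm: "measure_prob (\<psi> x t) {..<d} = 1" if "t \<le> T" for x t
    using that by (simp add: inner_vec_self)
  then have mass: "(\<Sum>i<n. measure_prob (\<psi> x t) (?B i)) = 1" if "t \<le> T" for x t
    using that by (simp add: measure_prob_def state_blocks d_def)
  \<comment> \<open>A related pair is stored as an input together with the flipped position;
    \<open>R'\<close> holds the same pairs seen from \<open>Y\<close>.\<close>
  define R where "R = Sigma X (\<lambda>x. {i. i < n \<and> flip x i \<in> Y})"
  define R' where "R' = Sigma Y (\<lambda>y. {i. i < n \<and> flip y i \<in> X})"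
  have fin: "finite X" "finite Y"
    using X Y by (auto intro!: finite_bit_strings[of _ n])
  have pos: "card X > 0" "card Y > 0"
    using X Y fin by (simp_all add: card_gt_0_iff)
  have bij: "bij_betw (\<lambda>(x, i). (flip x i, i)) R R'"
    by (rule bij_betw_byWitness[of _ "\<lambda>(x, i). (flip x i, i)"]) (auto simp: R_def R'_def)
  have "card X * m \<le> card R"
  proof -
    have "card R = (\<Sum>x\<in>X. flips Y x)"
      using X fin by (auto simp: R_def flips_def intro!: sum.cong)
    then show ?thesis
      using sum_mono[of X "\<lambda>_. m" "flips Y"] m by simp
  qed
  moreover have "card Y * m' \<le> card R"
  proof -
    have "card R' = (\<Sum>y\<in>Y. flips X y)"
      using Y fin by (auto simp: R'_def flips_def intro!: sum.cong)
    then show ?thesis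
      using sum_mono[of Y "\<lambda>_. m'" "flips X"] m' bij_betw_same_card[OF bij] by simp
  qed
  \<comment> \<open>Both lower bounds count the same pairs; \<open>card R\<close> is at least their
    geometric mean.\<close>
  ultimately have "real (card X * m) * real (card Y * m') \<le> real (card R) * real (card R)"
    by (intro mult_mono) (simp_all only: of_nat_le_iff of_nat_0_le_iff)
  then have cardR: "sqrt (real m * real m') * sqrt (real (card X) * real (card Y)) \<le> real (card R)"
    by (subst real_sqrt_mult[symmetric], intro real_le_lsqrt) (simp_all add: power2_eq_square ac_simps)
  \<comment> \<open>This weight makes \<open>r * card X\<close> and \<open>card Y / r\<close> equal,
    which minimises their sum.\<close>
  define r where "r = sqrt (real (card Y) / real (card X))"
  have r: "r > 0" "r * real (card X) + real (card Y) / r = 2 * sqrt (real (card X) * real (card Y))"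
  proof -
    define a b where "a = sqrt (real (card X))" and "b = sqrt (real (card Y))"
    have "a > 0" "b > 0" "real (card X) = a\<^sup>2" "real (card Y) = b\<^sup>2" "r = b / a"
      using pos by (simp_all add: a_def b_def r_def real_sqrt_divide)
    then show "r > 0" "r * real (card X) + real (card Y) / r = 2 * sqrt (real (card X) * real (card Y))"
      by (simp_all add: real_sqrt_mult power2_eq_square)
  qed
  define W where "W t = (\<Sum>(x, i)\<in>R. cmod (inner_vec d (\<psi> x t) (\<psi> (flip x i) t)))" for t
  have step: "W t - W (Suc t) \<le> 2 * sqrt (real (card X) * real (card Y))" if "Suc t \<le> T" for t
  proof -
    let ?a = "\<lambda>x i. measure_prob (\<psi> x t) (?B i)"
    \<comment> \<open>For a fixed input the masses of all \<open>n\<close> intervals sum to 1, so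
      each input contributes at most 1.\<close>
    have finB: "(\<Sum>(x, i)\<in>Q. ?a x i) \<le> real (card Z)"
      if "finite Z" "Q \<subseteq> Z \<times> {..<n}" for Q Z
    proof -
      have "(\<Sum>(x, i)\<in>Q. ?a x i) \<le> (\<Sum>(x, i)\<in>Z \<times> {..<n}. ?a x i)"
        using that by (intro sum_mono2) (auto simp: measure_prob_def sum_nonneg)
      also have "\<dots> = real (card Z)"
        using mass \<open>Suc t \<le> T\<close> by (simp flip: sum.cartesian_product)
      finally show ?thesis .
    qed
    have "W t - W (Suc t) = (\<Sum>(x, i)\<in>R. cmod (inner_vec d (\<psi> x t) (\<psi> (flip x i) t)) -
        cmod (inner_vec d (\<psi> x (Suc t)) (\<psi> (flip x i) (Suc t))))"
      by (simp add: W_def sum_subtractf case_prod_unfold)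
    also have "\<dots> \<le> (\<Sum>(x, i)\<in>R. r * ?a x i + ?a (flip x i) i / r)"
    proof (intro sum_mono, clarify)
      fix x i assume "(x, i) \<in> R"
      then have xi: "length x = n" "i < n"
        using X by (auto simp: R_def)
      have "query_mat n w z *\<^sub>v \<psi> z t \<in> carrier_vec d" for z
        using carrier[of t z] that query_mat_carrier[of n w z]
        by (auto simp: d_def intro!: mult_mat_vec_carrier)
      then have "inner_vec d (\<psi> x (Suc t)) (\<psi> (flip x i) (Suc t)) =
          inner_vec d (query_mat n w x *\<^sub>v \<psi> x t) (query_mat n w (flip x i) *\<^sub>v \<psi> (flip x i) t)"
        using that U[OF that] by (simp add: \<psi>_def d_def inner_vec_unitary)
      moreover have "cmod (inner_vec d (\<psi> x t) (\<psi> (flip x i) t) -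
          inner_vec d (query_mat n w x *\<^sub>v \<psi> x t) (query_mat n w (flip x i) *\<^sub>v \<psi> (flip x i) t))
          \<le> r * ?a x i + ?a (flip x i) i / r"
        using carrier[of t] that xi unfolding d_def
        by (intro inner_vec_query_flip w r(1)) auto
      ultimately show "cmod (inner_vec d (\<psi> x t) (\<psi> (flip x i) t)) -
          cmod (inner_vec d (\<psi> x (Suc t)) (\<psi> (flip x i) (Suc t))) \<le> r * ?a x i + ?a (flip x i) i / r"
        by (metis norm_triangle_ineq2 order_trans)
    qed
    also have "\<dots> = r * (\<Sum>(x, i)\<in>R. ?a x i) + (\<Sum>(x, i)\<in>R. ?a (flip x i) i) / r"
      by (simp add: sum.distrib sum_distrib_left sum_divide_distrib case_prod_unfold)
    also have "(\<Sum>(x, i)\<in>R. ?a (flip x i) i) = (\<Sum>(x, i)\<in>R'. ?a x i)"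
      using sum.reindex_bij_betw[OF bij, of "\<lambda>(x, i). ?a x i"] by (simp add: case_prod_unfold)
    also have "r * (\<Sum>(x, i)\<in>R. ?a x i) + (\<Sum>(x, i)\<in>R'. ?a x i) / r \<le> r * real (card X) + real (card Y) / r"
      using r(1) fin by (intro add_mono mult_left_mono divide_right_mono finB) (auto simp: R_def R'_def)
    finally show ?thesis
      using r(2) by simp
  qed
  have "W 0 \<le> W t + real t * (2 * sqrt (real (card X) * real (card Y)))" if "t \<le> T" for t
    using that
  proof (induction t)
    case (Suc t)
    then show ?case
      using step[of t] by (simp add: algebra_simps)
  qed simp
  from this[of T] have "W 0 \<le> W T + real T * (2 * sqrt (real (card X) * real (card Y)))"
    by simp
  \<comment> \<open>Before the first query the state does not depend on the input.\<close>
  moreover have "W 0 = real (card R)"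
  proof -
    have "inner_vec d (\<psi> x 0) (\<psi> y 0) = 1" for x y
      using self[of 0 x] by (simp add: \<psi>_def)
    then show ?thesis
      by (simp add: W_def)
  qed
  moreover have "W T \<le> 19 / 20 * real (card R)"
  proof -
    have "W T \<le> (\<Sum>(x, i)\<in>R. 19 / 20)"
      unfolding W_def
    proof (intro sum_mono, clarify)
      fix x i assume "(x, i) \<in> R"
      then have "length x = n" "g x" "length (flip x i) = n" "\<not> g (flip x i)"
        using X Y by (auto simp: R_def)
      then show "cmod (inner_vec d (\<psi> x T) (\<psi> (flip x i) T)) \<le> 19 / 20"
        using correct[of x] correct[of "flip x i"] A norm[of T]
        by (intro inner_vec_distinguish[of _ d _ A]) (auto simp: \<psi>_def d_def)
    qed
    then show ?thesis by simp
  qed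
  \<comment> \<open>The required loss of \<open>card R / 20\<close> is at most \<open>2 * T\<close>
    times the root, hence the factor 40.\<close>
  ultimately have "real (card R) \<le> (40 * real T) * sqrt (real (card X) * real (card Y))"
    by simp
  with cardR have "sqrt (real m * real m') * sqrt (real (card X) * real (card Y))
      \<le> (40 * real T) * sqrt (real (card X) * real (card Y))"
    by linarith
  then show ?thesis
    using pos by (simp add: mult_le_cancel_right)
qed

subsection \<open>Hard inputs for the Dyck language\<close>

text \<open>The extra parenthesis gives trees of value 1 balance 0 and trees of value 0 balance 2. A
  row of trees of value 1 is thus balanced, and its height does not grow with their number.\<close>

definition closed_tree :: "nat \<Rightarrow> bool \<Rightarrow> bool list set" where
  "closed_tree l b = (\<lambda>s. s @ [False]) ` tree l b"

lemma balance_closed_tree: "s \<in> closed_tree l b \<Longrightarrow> balance s = (if b then 0 else 2)"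
  by (auto simp: closed_tree_def balance_tree)

lemma height_le_closed_tree: "s \<in> closed_tree l b \<Longrightarrow> height_le (9 * l + 2) s"
  unfolding closed_tree_def
  by (auto intro!: height_le_append[OF _ height_le_single] simp: balance_tree
      elim!: height_le_mono[OF height_le_tree])

lemma length_closed_tree: "s \<in> closed_tree l b \<Longrightarrow> 7 * length s = 8 ^ Suc l + 6"
  using length_tree by (force simp: closed_tree_def)

lemma flips_closed_tree:
  "s \<in> closed_tree l b \<Longrightarrow> (if b then 5 else 4) ^ l \<le> flips (closed_tree l (\<not> b)) s"
  using flips_tree[of _ l b] flips_surround[of "tree l (\<not> b)" _ "[]" "[False]"]
  unfolding closed_tree_def by (fastforce intro: order_trans)

section \<open>Padding to a prescribed length\<close>

lemma prefix_replicate: "prefix p (replicate m b) \<Longrightarrow> \<exists>i\<le>m. p = replicate i b"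
proof (induction m arbitrary: p)
  case (Suc m)
  show ?case
  proof (cases p)
    case (Cons c q)
    then obtain i where "i \<le> m" "p = replicate (Suc i) b"
      using Suc by auto
    then show ?thesis by blast
  qed simp
qed simp

definition zigzag :: "nat \<Rightarrow> bool list" where
  "zigzag r = concat (replicate r [False, True])"

lemma prefix_zigzag: "prefix p (zigzag r) \<Longrightarrow> balance p \<in> {0..1}"
  by (induction r arbitrary: p) (auto simp: zigzag_def prefix_Cons)

lemma length_zigzag: "length (zigzag r) = 2 * r"
  by (induction r) (auto simp: zigzag_def)

lemma balance_zigzag: "balance (zigzag r) = 0"
  by (induction r) (auto simp: zigzag_def)

text \<open>The opening parentheses lift the band from -h to h into 0 to 2h, the closing ones undo
  the lift, and the zigzag fills up the length.\<close>

definition padded :: "nat \<Rightarrow> nat \<Rightarrow> bool list \<Rightarrow> bool list" where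
  "padded h r s = replicate h False @ s @ replicate h True @ zigzag r"

lemma balance_padded: "balance (padded h r s) = balance s"
  by (simp add: padded_def balance_zigzag)

lemma length_padded: "length (padded h r s) = 2 * h + length s + 2 * r"
  by (simp add: padded_def length_zigzag)

lemma dyck_padded:
  assumes s: "height_le h s" "balance s = 0" and h: "0 < h" "2 * h \<le> k"
  shows "dyck k (padded h r s)"
  unfolding dyck_def
proof (intro conjI allI impI)
  show "balance (padded h r s) = 0"
    by (simp add: balance_padded s)
  fix p assume "prefix p (padded h r s)"
  then consider "prefix p (replicate h False)"
    | q where "p = replicate h False @ q" "prefix q s"
    | q where "p = replicate h False @ s @ q" "prefix q (replicate h True)"
    | q where "p = replicate h False @ s @ replicate h True @ q" "prefix q (zigzag r)"
    unfolding padded_def prefix_append by blast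
  then have "0 \<le> balance p \<and> balance p \<le> int (2 * h)"
  proof cases
    case 1
    then show ?thesis
      using prefix_replicate[of p h False] by auto
  next
    case 2
    then show ?thesis
      using s(1) by (auto simp: height_le_def abs_le_iff)
  next
    case 3
    then show ?thesis
      using s(2) prefix_replicate[of q h True] by auto
  next
    case 4
    then show ?thesis
      using s(2) h(1) prefix_zigzag[of q r] by auto
  qed
  then show "0 \<le> balance p" "balance p \<le> int k"
    using h(2) by auto
qed

text \<open>The adversary bound with m = N 5^l and m' = 4^l. The height limit \<open>22 * l\<close>
  covers \<open>2 * h = 18 * l + 4\<close>.\<close>

lemma dyck_query_bound:
  assumes l: "l \<ge> 1" and n: "even n" "n \<ge> 400 ^ l"
    and comp: "quantum_computes n (dyck (22 * l)) T"
  shows "sqrt (2 ^ l * real n) \<le> 80 * real T"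
proof -
  define h where "h = 9 * l + 2"
  obtain t where t: "t \<in> closed_tree l True"
    using tree_nonempty[of l True] by (auto simp: closed_tree_def)
  define L where "L = length t"
  have L: "7 * L = 8 ^ Suc l + 6"
    using length_closed_tree[OF t] by (simp add: L_def)
  have length_L: "length s = L" if "s \<in> closed_tree l b" for s b
    using length_closed_tree[OF that] L by simp
  define N where "N = (n - 2 * h) div L"
  define r where "r = (n - 2 * h) mod L div 2"
  have pow: "(1::nat) \<le> 8 ^ l" "l \<le> 8 ^ l"
    using less_exp[of l] power_mono[of 2 8 l] by simp_all
  then have L_le: "L \<le> 2 * 8 ^ l" and L_pos: "L > 0"
    using L by (simp_all)
  \<comment> \<open>Since 400 = 50 * 8, the length \<open>n\<close> exceeds the padding and the
    remainder, both of order 8^l, by a constant factor.\<close>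
  have "(50::nat) * 8 ^ l \<le> 50 ^ l * 8 ^ l"
    using power_increasing[of 1 l "50::nat"] l by (intro mult_right_mono) auto
  also have "\<dots> \<le> n"
    using n(2) by (simp flip: power_mult_distrib)
  finally have n_ge: "50 * 8 ^ l \<le> n" .
  have h_le: "2 * h \<le> 22 * l" "22 * l \<le> 22 * 8 ^ l"
    using l pow by (simp_all add: h_def)
  \<comment> \<open>Both \<open>n\<close> and \<open>L\<close> are even, so the remaining length is
    even and can be filled by zigzag pairs.\<close>
  have "even (7 * L)"
    unfolding L by simp
  then have "even L" by simp
  then have "even ((n - 2 * h) mod L)"
    using n(1) by (simp add: dvd_mod)
  then have r: "2 * r = (n - 2 * h) mod L"
    by (simp add: r_def)
  have n_eq: "n = 2 * h + N * L + 2 * r"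
  proof -
    have "2 * h \<le> n"
      using h_le n_ge by linarith
    then show ?thesis
      unfolding r N_def by simp
  qed
  have "2 * r < L"
    using L_pos by (simp add: r)
  moreover have "N * L \<le> N * (2 * 8 ^ l)"
    using L_le by simp
  \<comment> \<open>Padding and remainder take at most 24 * 8^l, which is less than half of
    \<open>n\<close>; the trees fill the rest.\<close>
  ultimately have n_le: "n \<le> 4 * N * 8 ^ l"
    using n_eq n_ge h_le L_le by linarith
  have "n > 0"
    using n_ge pow by linarith
  then obtain a where a: "N = Suc a"
    using n_le by (cases N) auto
  define X where "X = padded h r ` blocks (closed_tree l) True (Suc a) 0"
  define Y where "Y = padded h r ` blocks (closed_tree l) True a (Suc 0)"
  have padded: "padded h r = (\<lambda>s. replicate h False @ s @ (replicate h True @ zigzag r))"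
    by (simp add: padded_def fun_eq_iff)
  have mono: "flips P s \<le> flips (padded h r ` P) (padded h r s)" for P s
    unfolding padded by (rule flips_surround)
  have nonempty: "closed_tree l b \<noteq> {}" for b
    by (simp add: closed_tree_def tree_nonempty)
  have "sqrt (real (Suc a * 5 ^ l) * real (Suc 0 * 4 ^ l)) \<le> 40 * real T"
  proof (rule sensitivity_adversary[OF \<open>n > 0\<close> comp])
    show "X \<subseteq> {x. length x = n \<and> dyck (22 * l) x}"
    proof
      fix x assume "x \<in> X"
      then obtain s where s: "s \<in> blocks (closed_tree l) True (Suc a) 0" "x = padded h r s"
        unfolding X_def by blast
      \<comment> \<open>All trees here have value 1 and balance 0, so the height of the row is that
        of a single tree.\<close>
      have "height_le (h + Suc a * (if True then 0 else 2) + 0 * (if \<not> True then 0 else 2)) s"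
        unfolding h_def
        by (rule height_le_blocks[OF s(1)])
           (auto simp: balance_closed_tree dest: height_le_closed_tree)
      then have "height_le h s"
        by simp
      have "length s = (Suc a + 0) * L"
        using length_blocks[OF s(1) length_L] .
      then have "length x = n"
        using n_eq a by (simp add: s(2) length_padded)
      moreover note \<open>height_le h s\<close>
      moreover have "balance s = 0"
        using balance_blocks[OF s(1) balance_closed_tree] by simp
      ultimately show "x \<in> {x. length x = n \<and> dyck (22 * l) x}"
        using dyck_padded[of h s "22 * l" r] h_le by (simp add: h_def s(2))
    qed
    show "Y \<subseteq> {y. length y = n \<and> \<not> dyck (22 * l) y}"
    proof
      fix y assume "y \<in> Y"
      then obtain s where s: "s \<in> blocks (closed_tree l) True a (Suc 0)" "y = padded h r s"
        unfolding Y_def by blast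
      have "length s = (a + Suc 0) * L"
        using length_blocks[OF s(1) length_L] .
      then have "length y = n"
        using n_eq a by (simp add: s(2) length_padded)
      \<comment> \<open>The single tree of value 0 leaves a total balance of 2, so the input is
        rejected.\<close>
      moreover have "balance y = 2"
        using balance_blocks[OF s(1) balance_closed_tree] by (simp add: s(2) balance_padded)
      ultimately show "y \<in> {y. length y = n \<and> \<not> dyck (22 * l) y}"
        by (simp add: dyck_def)
    qed
    show "X \<noteq> {}" "Y \<noteq> {}"
      using nonempty by (simp_all add: X_def Y_def blocks_nonempty)
    show "Suc a * 5 ^ l \<le> flips Y x" if x: "x \<in> X" for x
    proof -
      obtain s where s: "s \<in> blocks (closed_tree l) True (Suc a) 0" "x = padded h r s"
        using x unfolding X_def by blast
      have "Suc a * 5 ^ l \<le> flips (blocks (closed_tree l) True a (Suc 0)) s"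
        using flips_closed_tree[of _ l True] by (intro flips_blocks[OF s(1)]) simp
      then show ?thesis
        using mono unfolding Y_def s(2) by (rule order_trans)
    qed
    show "Suc 0 * 4 ^ l \<le> flips X y" if y: "y \<in> Y" for y
    proof -
      \<comment> \<open>The roles of the values are exchanged, so that the one tree of value 0 is
        the block to be changed.\<close>
      obtain s where s: "s \<in> blocks (closed_tree l) False (Suc 0) a" "y = padded h r s"
        using y blocks_swap[of "closed_tree l" True a "Suc 0"] unfolding Y_def by auto
      have "Suc 0 * 4 ^ l \<le> flips (blocks (closed_tree l) False 0 (Suc a)) s"
        using flips_closed_tree[of _ l False] by (intro flips_blocks[OF s(1)]) simp
      also have "blocks (closed_tree l) False 0 (Suc a) = blocks (closed_tree l) True (Suc a) 0"
        by (subst blocks_swap) simp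
      finally show ?thesis
        using mono unfolding X_def s(2) by (rule order_trans)
    qed
  qed
  moreover have "sqrt (2 ^ l * real n) \<le> 2 * sqrt (real (Suc a * 5 ^ l) * real (Suc 0 * 4 ^ l))"
  proof -
    \<comment> \<open>As \<open>n\<close> is at most 4 N 8^l, the product is at most 4 N 16^l, and
      16^l is at most 20^l = 5^l 4^l.\<close>
    have "2 ^ l * n \<le> 2 ^ l * (4 * N * 8 ^ l)"
      using n_le by simp
    also have "\<dots> = 4 * N * 16 ^ l"
      by (simp flip: power_mult_distrib)
    also have "\<dots> \<le> 4 * N * 20 ^ l"
      by (intro mult_left_mono power_mono) auto
    also have "\<dots> = 4 * (Suc a * 5 ^ l * (Suc 0 * 4 ^ l))"
      using power_mult_distrib[of "5::nat" 4 l] by (simp add: a algebra_simps)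
    finally have "real (2 ^ l * n) \<le> real (4 * (Suc a * 5 ^ l * (Suc 0 * 4 ^ l)))"
      by (simp only: of_nat_le_iff)
    then have "sqrt (2 ^ l * real n) \<le> sqrt (4 * (real (Suc a * 5 ^ l) * real (Suc 0 * 4 ^ l)))"
      by (intro real_sqrt_le_mono) simp
    then show ?thesis
      by (simp only: real_sqrt_mult real_sqrt_four)
  qed
  ultimately show ?thesis by linarith
qed

text \<open>For odd \<open>n\<close> no input is balanced and the function is constant, hence the
  restriction to even \<open>n\<close>. As \<open>n\<close> queries always suffice, a bound of order
  2^(l/2) sqrt n forces \<open>n\<close> to be exponentially large in \<open>l\<close>, hence
  \<open>B ^ l\<close>.\<close>

theorem theorem6:
  shows "\<exists>c1::nat. c1 > 0 \<and>
    (\<exists>(C::real) (B::nat). C > 0 \<and>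
      (\<forall>l n :: nat. l \<ge> 1 \<longrightarrow> even n \<longrightarrow> n \<ge> B ^ l \<longrightarrow> n \<ge> 1 \<longrightarrow>
        ereal_of_enat (quantum_query_complexity n (dyck (c1 * l)))
          \<ge> ereal (C * 2 powr (real l / 2) * sqrt (real n))))"
proof (rule exI[of _ 22], rule conjI, simp, rule exI[of _ "1 / 80"], rule exI[of _ 400],
    intro conjI allI impI)
  fix l n :: nat
  assume *: "l \<ge> 1" "even n" "n \<ge> 400 ^ l"
  let ?Q = "{T. quantum_computes n (dyck (22 * l)) T}"
  have "2 powr (real l / 2) = sqrt (2 ^ l)"
    by (simp add: powr_half_sqrt[symmetric] powr_powr flip: powr_realpow)
  then have bound: "1 / 80 * 2 powr (real l / 2) * sqrt (real n) \<le> real T" if "T \<in> ?Q" for T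
    using dyck_query_bound[OF *, of T] that by (simp add: real_sqrt_mult)
  show "ereal (1 / 80 * 2 powr (real l / 2) * sqrt (real n))
      \<le> ereal_of_enat (quantum_query_complexity n (dyck (22 * l)))"
  \<comment> \<open>If no number of queries suffices, the complexity is infinite; otherwise the
    infimum is attained by an actual algorithm.\<close>
  proof (cases "?Q = {}")
    case True
    then show ?thesis
      by (simp add: quantum_query_complexity_def top_enat_def)
  next
    case False
    then obtain T where "enat T \<in> enat ` ?Q"
      by blast
    then have "quantum_query_complexity n (dyck (22 * l)) \<in> enat ` ?Q"
      unfolding quantum_query_complexity_def by (rule wellorder_InfI)
    then show ?thesis
      using bound by auto
  qed
qed auto

end
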